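(* The Modified Dhar's Burning Algorithm (defined in the context) is correct: for every graph $G$ and every input divisor $D$ on $G$, if the algorithm returns a divisor $D'$, then $D'\ge 0$ and $D'\sim D$; and if it returns NONE, then there is no divisor $D'\sim D$ with $D'\geq 0$.
   Context: All graphs are finite, connected, loopless multigraphs with nonempty vertex set $V(G)$. A divisor on $G$ is an element $D=\sum_v D(v)\cdot v$ of the free abelian group on $V(G)$; $D\ge 0$ (effective) means $D(v)\ge 0$ for all $v$. Write $D=D^+-D^-$ with $D^+(v)=\max\{D(v),0\}$, $D^-(v)=\max\{-D(v),0\}$, and let $\mathrm{supp}(D^-)=\{v: D(v)<0\}$. For $W\subseteq V(G)$ and $v\in W$, $\mathrm{outdeg}_W(v)$ is the number of edges from $v$ to $V(G)\setminus W$. Let $\Delta:\mathbb{Z}^{V(G)}\to \mathrm{Div}(G)$ be the map given by the Laplacian matrix (diagonal entries the valences $\mathrm{val}(v)$, off-diagonal entries minus the number of edges between the two vertices), and let $\mathbb{1}_W$ be the indicator function of $W$. Divisors $D,D'$ are linearly equivalent, $D\sim D'$, if $D-D'$ lies in the image of $\Delta$. Modified Dhar's Burning Algorithm, on input a divisor $D$: (1) If $D\ge 0$, return $D$. (2) Set $W:=V(G)\setminus\mathrm{supp}(D^-)$. (3) While $W\neq\emptyset$: if there is some $v\in W$ with $D(v)<\mathrm{outdeg}_W(v)$, replace $W$ by $W\setminus\{v\}$; otherwise, call the algorithm recursively on $D-\Delta\mathbb{1}_W$ and return its result. (4) If $W=\emptyset$ is reached, return NONE. *)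

theory Defs
  imports
    "HOL-Algebra.Free_Abelian_Groups"
    "HOL-Library.Indicator_Function"
begin

record ('v, 'e) mgraph =
  verts :: "'v set"
  edges :: "'e set"
  ends :: "'e \<Rightarrow> 'v set"

text \<open>Edges have names of their own, so that parallel edges are allowed; the condition that every
  edge has two distinct ends excludes loops.\<close>

definition connected_multigraph :: "('v, 'e) mgraph \<Rightarrow> bool" where
  "connected_multigraph G \<longleftrightarrow>
     finite (verts G) \<and> verts G \<noteq> {} \<and> finite (edges G) \<and>
     (\<forall>e\<in>edges G. ends G e \<subseteq> verts G \<and> card (ends G e) = 2) \<and>
     (\<forall>u\<in>verts G. \<forall>v\<in>verts G. (u, v) \<in> {(x, y). \<exists>e\<in>edges G. ends G e = {x, y}}\<^sup>*)"

definition valence :: "('v, 'e) mgraph \<Rightarrow> 'v \<Rightarrow> nat" where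
  "valence G v = card {e \<in> edges G. v \<in> ends G e}"

definition num_edges :: "('v, 'e) mgraph \<Rightarrow> 'v \<Rightarrow> 'v \<Rightarrow> nat" where
  "num_edges G u v = card {e \<in> edges G. ends G e = {u, v}}"

definition outdeg :: "('v, 'e) mgraph \<Rightarrow> 'v set \<Rightarrow> 'v \<Rightarrow> nat" where
  "outdeg G W v = card {e \<in> edges G. \<exists>w \<in> verts G - W. ends G e = {v, w}}"

definition divisors :: "('v, 'e) mgraph \<Rightarrow> ('v \<Rightarrow>\<^sub>0 int) set" where
  "divisors G = carrier (free_Abelian_group (verts G))"

definition effective :: "('v, 'e) mgraph \<Rightarrow> ('v \<Rightarrow>\<^sub>0 int) \<Rightarrow> bool" where
  "effective G D \<longleftrightarrow> (\<forall>v \<in> verts G. Poly_Mapping.lookup D v \<ge> 0)"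

definition supp_neg :: "('v, 'e) mgraph \<Rightarrow> ('v \<Rightarrow>\<^sub>0 int) \<Rightarrow> 'v set" where
  "supp_neg G D = {v \<in> verts G. Poly_Mapping.lookup D v < 0}"

definition laplacian_entry :: "('v, 'e) mgraph \<Rightarrow> 'v \<Rightarrow> 'v \<Rightarrow> int" where
  "laplacian_entry G u v = (if u = v then int (valence G v) else - int (num_edges G u v))"

text \<open>Only the values of \<open>f\<close> on the vertices matter, so the range of \<open>laplacian G\<close> is the image of
  the Laplacian on integer-valued functions on the vertex set.\<close>

definition laplacian :: "('v, 'e) mgraph \<Rightarrow> ('v \<Rightarrow> int) \<Rightarrow> ('v \<Rightarrow>\<^sub>0 int)" where
  "laplacian G f =
     (\<Sum>u\<in>verts G. Poly_Mapping.single u (\<Sum>v\<in>verts G. laplacian_entry G u v * f v))"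

definition lin_equiv :: "('v, 'e) mgraph \<Rightarrow> ('v \<Rightarrow>\<^sub>0 int) \<Rightarrow> ('v \<Rightarrow>\<^sub>0 int) \<Rightarrow> bool" where
  "lin_equiv G D D' \<longleftrightarrow>
     D \<in> divisors G \<and> D' \<in> divisors G \<and> D - D' \<in> range (laplacian G)"

text \<open>Big-step semantics of the algorithm. The vertex removed in a step of the while loop is not
  prescribed, so the algorithm is a relation: \<open>dhar G D r\<close> means that some run on input \<open>D\<close> halts
  with result \<open>r\<close>, and \<open>dhar_loop G D W r\<close> that some run of the while loop, entered with the current
  set \<open>W\<close>, does. The result \<open>None\<close> stands for NONE.\<close>

inductive
  dhar :: "('v, 'e) mgraph \<Rightarrow> ('v \<Rightarrow>\<^sub>0 int) \<Rightarrow> ('v \<Rightarrow>\<^sub>0 int) option \<Rightarrow> bool" and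
  dhar_loop :: "('v, 'e) mgraph \<Rightarrow> ('v \<Rightarrow>\<^sub>0 int) \<Rightarrow> 'v set \<Rightarrow> ('v \<Rightarrow>\<^sub>0 int) option \<Rightarrow> bool"
  for G :: "('v, 'e) mgraph"
where
  return_effective: "effective G D \<Longrightarrow> dhar G D (Some D)"
| enter_loop: "\<not> effective G D \<Longrightarrow> dhar_loop G D (verts G - supp_neg G D) r \<Longrightarrow> dhar G D r"
| burn: "v \<in> W \<Longrightarrow> Poly_Mapping.lookup D v < int (outdeg G W v) \<Longrightarrow>
    dhar_loop G D (W - {v}) r \<Longrightarrow> dhar_loop G D W r"
| recurse: "W \<noteq> {} \<Longrightarrow> \<forall>v\<in>W. \<not> Poly_Mapping.lookup D v < int (outdeg G W v) \<Longrightarrow>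
    dhar G (D - laplacian G (indicator W)) r \<Longrightarrow> dhar_loop G D W r"
| return_none: "dhar_loop G D {} None"

end

theory Submission
  imports Defs
begin

text \<open>If \<open>D'\<close> is effective and \<open>D' = D + \<Delta> g\<close>, let \<open>A\<close> be the set of vertices where \<open>g\<close> is
  minimal. On \<open>A\<close> the Laplacian of \<open>g\<close> is at most \<open>- outdeg\<^sub>A\<close>, so \<open>D v \<ge> outdeg\<^sub>A v \<ge> 0\<close> there. Hence
  \<open>A\<close> lies in the initial set \<open>W\<close>, and no vertex of \<open>A\<close> can ever burn, because the outdegree at a
  vertex only grows when \<open>W\<close> shrinks. So \<open>W\<close> never becomes empty in a call on a divisor that is
  equivalent to an effective one, and firing \<open>W\<close> does not change the class.\<close>

text \<open>An edge and one of its ends determine the other end, so the edges from \<open>v\<close>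
  out of \<open>W\<close> split disjointly according to that other end.\<close>

lemma outdeg_eq_sum_num_edges:
  assumes "finite (verts G)" and "finite (edges G)"
  shows "outdeg G W v = (\<Sum>w\<in>verts G - W. num_edges G v w)"
proof -
  have "{e \<in> edges G. \<exists>w \<in> verts G - W. ends G e = {v, w}}
      = (\<Union>w\<in>verts G - W. {e \<in> edges G. ends G e = {v, w}})"
    by blast
  then show ?thesis
    unfolding outdeg_def num_edges_def
    using assms by (simp, subst card_UN_disjoint) (auto simp: doubleton_eq_iff)
qed

lemma outdeg_antimono:
  assumes "finite (edges G)" and "W \<subseteq> W'"
  shows "outdeg G W' v \<le> outdeg G W v"
  unfolding outdeg_def using assms by (intro card_mono) auto

lemma valence_eq_sum_num_edges:
  assumes "connected_multigraph G"
  shows "valence G v = (\<Sum>w\<in>verts G. num_edges G v w)"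
proof -
  have "\<exists>w\<in>verts G. ends G e = {v, w}" if "e \<in> edges G" "v \<in> ends G e" for e
  proof -
    have "ends G e \<subseteq> verts G" "card (ends G e) = 2"
      using assms that(1) by (auto simp: connected_multigraph_def)
    with that(2) show ?thesis
      by (auto simp: card_2_iff)
  qed
  \<comment> \<open>With nothing in \<open>W\<close>, every edge at \<open>v\<close> leaves
    \<open>W\<close>, so the valence is an outdegree.\<close>
  then have "{e \<in> edges G. v \<in> ends G e}
      = {e \<in> edges G. \<exists>w \<in> verts G - {}. ends G e = {v, w}}"
    by auto
  then have "valence G v = outdeg G {} v"
    unfolding valence_def outdeg_def by simp
  with assms show ?thesis
    by (simp add: outdeg_eq_sum_num_edges connected_multigraph_def)
qed

lemma num_edges_self:
  assumes "connected_multigraph G"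
  shows "num_edges G v v = 0"
proof -
  have "ends G e \<noteq> {v}" if "e \<in> edges G" for e
    using assms that by (fastforce simp: connected_multigraph_def)
  then have "{e \<in> edges G. ends G e = {v, v}} = {}"
    by auto
  then show ?thesis
    unfolding num_edges_def by (simp only: card.empty)
qed

lemma lookup_laplacian:
  assumes "finite (verts G)"
  shows "Poly_Mapping.lookup (laplacian G f) u
       = (if u \<in> verts G then \<Sum>v\<in>verts G. laplacian_entry G u v * f v else 0)"
  using assms by (simp add: laplacian_def lookup_sum lookup_single when_def sum.delta)

text \<open>The rows of the Laplacian sum to zero. In terms of differences of \<open>f\<close>, the
  sign of each summand is visible at a minimum of \<open>f\<close>.\<close>

lemma lookup_laplacian_eq_sum_diff:
  assumes G: "connected_multigraph G" and u: "u \<in> verts G"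
  shows "Poly_Mapping.lookup (laplacian G f) u
       = (\<Sum>v\<in>verts G. int (num_edges G u v) * (f u - f v))"
proof -
  have fin: "finite (verts G)"
    using G by (simp add: connected_multigraph_def)
  \<comment> \<open>Absence of loops makes the subtracted term vanish at \<open>v = u\<close>, so it
    can be summed over all vertices.\<close>
  have "laplacian_entry G u v * f v
      = (if v = u then int (valence G u) * f u else 0) - int (num_edges G u v) * f v" for v
    using num_edges_self[OF G] by (simp add: laplacian_entry_def)
  then have "Poly_Mapping.lookup (laplacian G f) u
      = int (valence G u) * f u - (\<Sum>v\<in>verts G. int (num_edges G u v) * f v)"
    using fin u by (simp add: lookup_laplacian sum_subtractf sum.delta)
  then show ?thesis
    by (simp add: valence_eq_sum_num_edges[OF G] right_diff_distrib sum_subtractf sum_distrib_right)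
qed

lemma laplacian_add:
  assumes "finite (verts G)"
  shows "laplacian G (\<lambda>v. f v + g v) = laplacian G f + laplacian G g"
  using assms
  by (intro poly_mapping_eqI)
    (simp add: lookup_laplacian lookup_add distrib_left sum.distrib)

lemma laplacian_diff:
  assumes "finite (verts G)"
  shows "laplacian G (\<lambda>v. f v - g v) = laplacian G f - laplacian G g"
  using laplacian_add[OF assms, of "\<lambda>v. f v - g v" g] by simp

lemma laplacian_zero: "laplacian G (\<lambda>v. 0) = 0"
  by (simp add: laplacian_def)

lemma divisors_iff: "D \<in> divisors G \<longleftrightarrow> (\<forall>v. v \<notin> verts G \<longrightarrow> Poly_Mapping.lookup D v = 0)"
  by (auto simp: divisors_def free_Abelian_group_def in_keys_iff)

lemma diff_laplacian_in_divisors: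
  assumes "finite (verts G)" and "D \<in> divisors G"
  shows "D - laplacian G f \<in> divisors G"
  using assms by (simp add: divisors_iff lookup_minus lookup_laplacian)

lemma lin_equiv_refl: "D \<in> divisors G \<Longrightarrow> lin_equiv G D D"
  unfolding lin_equiv_def using laplacian_zero[of G] by (metis diff_self rangeI)

text \<open>Taking \<open>f\<close> to be the indicator of \<open>W\<close>, this carries the class
  through a recursive call.\<close>

lemma lin_equiv_diff_laplacian_iff:
  assumes fin: "finite (verts G)" and D: "D \<in> divisors G"
  shows "lin_equiv G D' (D - laplacian G f) \<longleftrightarrow> lin_equiv G D' D"
proof -
  have "D' - (D - laplacian G f) \<in> range (laplacian G) \<longleftrightarrow> D' - D \<in> range (laplacian G)"
  proof
    assume "D' - (D - laplacian G f) \<in> range (laplacian G)"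
    then obtain g where "D' - (D - laplacian G f) = laplacian G g" by blast
    then have "D' - D = laplacian G (\<lambda>v. g v - f v)"
      by (simp add: laplacian_diff[OF fin] algebra_simps)
    then show "D' - D \<in> range (laplacian G)" by blast
  next
    assume "D' - D \<in> range (laplacian G)"
    then obtain g where "D' - D = laplacian G g" by blast
    then have "D' - (D - laplacian G f) = laplacian G (\<lambda>v. g v + f v)"
      by (simp add: laplacian_add[OF fin] algebra_simps)
    then show "D' - (D - laplacian G f) \<in> range (laplacian G)" by blast
  qed
  then show ?thesis
    using D diff_laplacian_in_divisors[OF fin D] by (simp add: lin_equiv_def)
qed

text \<open>No summand in the difference form is positive at a minimum. Edges inside the level set
  contribute 0, and each edge leaving it contributes at most -1 because \<open>g\<close> is
  integer-valued.\<close>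

lemma lookup_laplacian_le_outdeg_argmin:
  assumes G: "connected_multigraph G" and u: "u \<in> verts G"
    and min: "\<And>v. v \<in> verts G \<Longrightarrow> g u \<le> g v"
  shows "Poly_Mapping.lookup (laplacian G g) u \<le> - int (outdeg G {v \<in> verts G. g v = g u} u)"
proof -
  let ?A = "{v \<in> verts G. g v = g u}"
  have fin: "finite (verts G)" "finite (edges G)"
    using G by (auto simp: connected_multigraph_def)
  have "Poly_Mapping.lookup (laplacian G g) u
      = (\<Sum>v\<in>verts G - ?A. int (num_edges G u v) * (g u - g v))"
    unfolding lookup_laplacian_eq_sum_diff[OF G u]
    by (rule sum.mono_neutral_right) (use fin in auto)
  also have "\<dots> \<le> (\<Sum>v\<in>verts G - ?A. int (num_edges G u v) * (- 1))"
  proof (rule sum_mono)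
    fix v assume "v \<in> verts G - ?A"
    with min[of v] have "g u - g v \<le> - 1" by auto
    then show "int (num_edges G u v) * (g u - g v) \<le> int (num_edges G u v) * (- 1)"
      by (intro mult_left_mono) auto
  qed
  finally show ?thesis
    by (simp add: outdeg_eq_sum_num_edges[OF fin] sum_negf)
qed

lemma ex_unburnable_set:
  assumes G: "connected_multigraph G" and eq: "lin_equiv G D' D" and eff: "effective G D'"
  obtains A where "A \<noteq> {}" and "A \<subseteq> verts G"
    and "\<And>v. v \<in> A \<Longrightarrow> int (outdeg G A v) \<le> Poly_Mapping.lookup D v"
proof -
  obtain g where g: "D' - D = laplacian G g"
    using eq by (auto simp: lin_equiv_def)
  have "finite (verts G)" "verts G \<noteq> {}"
    using G by (auto simp: connected_multigraph_def)
  then obtain a where a: "a \<in> verts G" "\<And>v. v \<in> verts G \<Longrightarrow> g a \<le> g v"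
    using ex_min_if_finite[of "g ` verts G"] by (fastforce simp: not_less)
  let ?A = "{v \<in> verts G. g v = g a}"
  show thesis
  proof (rule that[of ?A])
    fix u assume "u \<in> ?A"
    then have u: "u \<in> verts G" and gu: "g a = g u" by auto
    \<comment> \<open>Every \<open>u\<close> in \<open>?A\<close> is itself a minimum of
      \<open>g\<close>, and its level set is again \<open>?A\<close>.\<close>
    have "Poly_Mapping.lookup (laplacian G g) u \<le> - int (outdeg G ?A u)"
      using lookup_laplacian_le_outdeg_argmin[OF G u, of g] a(2) unfolding gu by simp
    moreover have "Poly_Mapping.lookup D' u \<ge> 0"
      using eff u by (simp add: effective_def)
    ultimately show "int (outdeg G ?A u) \<le> Poly_Mapping.lookup D u"
      by (simp flip: g add: lookup_minus)
  qed (use a in auto)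
qed

text \<open>A divisor is returned only when it is effective, and reflexivity applies there because
  membership in \<open>divisors G\<close> is preserved by firing.\<close>

lemma dhar_Some_correct:
  assumes G: "connected_multigraph G"
  shows "dhar G D r \<Longrightarrow> D \<in> divisors G \<longrightarrow> r = Some D' \<longrightarrow> effective G D' \<and> lin_equiv G D' D"
    and "dhar_loop G D W r \<Longrightarrow>
      D \<in> divisors G \<longrightarrow> r = Some D' \<longrightarrow> effective G D' \<and> lin_equiv G D' D"
proof (induction rule: dhar_dhar_loop.inducts)
  case (recurse W D r)
  have "finite (verts G)"
    using G by (simp add: connected_multigraph_def)
  with recurse.IH show ?case
    using diff_laplacian_in_divisors lin_equiv_diff_laplacian_iff by blast
qed (auto simp: lin_equiv_refl)

text \<open>The claim about the loop assumes an unburnable set \<open>A\<close> inside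
  \<open>W\<close>, which survives each burning step. A recursive call needs no such set, since
  \<open>enter_loop\<close> finds a new one for the new divisor.\<close>

lemma dhar_None_correct:
  assumes G: "connected_multigraph G"
  shows "dhar G D r \<Longrightarrow> r = None \<longrightarrow> lin_equiv G D' D \<longrightarrow> \<not> effective G D'"
    and "dhar_loop G D W r \<Longrightarrow> r = None \<longrightarrow> lin_equiv G D' D \<longrightarrow>
      (\<exists>A. A \<noteq> {} \<and> A \<subseteq> W \<and> (\<forall>v\<in>A. int (outdeg G A v) \<le> Poly_Mapping.lookup D v)) \<longrightarrow>
      \<not> effective G D'"
proof (induction rule: dhar_dhar_loop.inducts)
  case (enter_loop D r)
  show ?case
  proof (intro impI notI)
    assume r: "r = None" and eq: "lin_equiv G D' D" and eff: "effective G D'"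
    obtain A where A: "A \<noteq> {}" "A \<subseteq> verts G"
        "\<And>v. v \<in> A \<Longrightarrow> int (outdeg G A v) \<le> Poly_Mapping.lookup D v"
      using ex_unburnable_set[OF G eq eff] by blast
    have "A \<subseteq> verts G - supp_neg G D"
      using A(2,3) by (force simp: supp_neg_def)
    with enter_loop.IH r eq eff A show False by blast
  qed
next
  case (burn v W D r)
  show ?case
  proof (intro impI, elim exE conjE)
    fix A
    assume *: "r = None" "lin_equiv G D' D" "A \<noteq> {}"
      and A: "A \<subseteq> W" "\<forall>v\<in>A. int (outdeg G A v) \<le> Poly_Mapping.lookup D v"
    have "outdeg G W v \<le> outdeg G A v"
      using G A(1) by (simp add: outdeg_antimono connected_multigraph_def)
    with burn(2) A(2) have "v \<notin> A" by force
    with A(1) have "A \<subseteq> W - {v}" by blast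
    with burn.IH * A(2) show "\<not> effective G D'" by metis
  qed
next
  case (recurse W D r)
  have "finite (verts G)"
    using G by (simp add: connected_multigraph_def)
  \<comment> \<open>The condition supplies \<open>D \<in> divisors G\<close>, which this induction
    does not carry along.\<close>
  then have "lin_equiv G D' (D - laplacian G (indicator W)) \<longleftrightarrow> lin_equiv G D' D"
    if "lin_equiv G D' D"
    using that by (intro lin_equiv_diff_laplacian_iff) (simp_all add: lin_equiv_def)
  with recurse.IH show ?case by blast
\<comment> \<open>An effective input does not give \<open>None\<close>, and an empty
  \<open>W\<close> contains no nonempty \<open>A\<close>.\<close>
qed auto

theorem proposition6p3:
  fixes G :: "('v, 'e) mgraph" and D :: "'v \<Rightarrow>\<^sub>0 int"
  assumes "connected_multigraph G" and "D \<in> divisors G"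
  shows "(\<forall>D'. dhar G D (Some D') \<longrightarrow> effective G D' \<and> lin_equiv G D' D) \<and>
         (dhar G D None \<longrightarrow> \<not> (\<exists>D'. lin_equiv G D' D \<and> effective G D'))"
  using assms dhar_Some_correct(1) dhar_None_correct(1) by blast

end
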